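(* Let $\Gamma$ be a $C^2$, strictly convex, $\mathbb{D}_2$-symmetric billiard curve, and let $Z$ be one of its $\mathbb{D}_2$-symmetric $2$-periodic Birkhoff billiard orbits, with constant segment length $L$ and curvature $\kappa$ along $Z$. If $\kappa L<2$, then $\Gamma$ admits, for each of the types I, II and V, infinitely many non-Birkhoff periodic billiard orbits of rotation number $\frac12$ of that type, with arbitrarily long minimal periods.
   Context: $\mathbb{D}_2=\langle R,S\rangle$, where $R$ is rotation by $\pi$ and $S$ is the horizontal reflection. Billiard curves are $C^2$, bound strictly convex domains, and are parametrized by $1$-periodic $C^2$ immersions $\gamma$ with $\gamma(x+1/2)=R\gamma(x)$ and $\gamma(-x)=S\gamma(x)$. Billiard sequences, orbits, lifts and the Birkhoff property are as usual: a lift $x$ with $0<x_{i+1}-x_i<1$ is Birkhoff if $x_i\le x_j+l\Rightarrow x_{i+m}\le x_{j+m}+l$ for all integers. For a periodic billiard orbit $z$ of minimal period $p$: - Type I: $H(z)=\mathbb{D}_2$, $R(z_i)=z_{p/2+i}$, and $S(z_i)=z_{k-i}$ for some $k$ (so both reflections act time-reversingly). - Type II: $H(z)=\mathbb{D}_2$, $R(z_i)=z_{k-i}$ for an odd $k$, and one of $S$, $RS$ maps $z_i$ to $z_{p/2+i}$. - Type V: $H(z)=\langle\sigma\rangle$ for a single reflection $\sigma$ with $\sigma(z_i)=z_{p/2+i}$ and $\sigma(z_i)=z_{k-i}$ for some $k$. Here $H(z)$ is the set of $h\in\mathbb{D}_2$ with $h(z_i)=z_{k+i}$ for all $i$, or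 $h(z_i)=z_{k-i}$ for all $i$, for some $k$. *)

theory Defs
  imports "HOL-Analysis.Analysis"
begin

definition rotR :: "complex \<Rightarrow> complex" where "rotR z = - z"
definition reflS :: "complex \<Rightarrow> complex" where "reflS z = cnj z"

definition D2 :: "(complex \<Rightarrow> complex) set" where
  "D2 = {id, rotR, reflS, rotR \<circ> reflS}"

definition C2 :: "(real \<Rightarrow> complex) \<Rightarrow> bool" where
  "C2 g \<longleftrightarrow> (\<exists>g1 g2. (\<forall>t. (g has_vector_derivative g1 t) (at t)) \<and>
                      (\<forall>t. (g1 has_vector_derivative g2 t) (at t)) \<and>
                      continuous_on UNIV g2)"

definition vel :: "(real \<Rightarrow> complex) \<Rightarrow> real \<Rightarrow> complex" where
  "vel g t = vector_derivative g (at t)"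

definition acc :: "(real \<Rightarrow> complex) \<Rightarrow> real \<Rightarrow> complex" where
  "acc g t = vector_derivative (vel g) (at t)"

definition curvature :: "(real \<Rightarrow> complex) \<Rightarrow> real \<Rightarrow> real" where
  "curvature g t = \<bar>Im (cnj (vel g t) * acc g t)\<bar> / (cmod (vel g t)) ^ 3"

definition strictly_convex_set :: "complex set \<Rightarrow> bool" where
  "strictly_convex_set K \<longleftrightarrow> convex K \<and>
     (\<forall>x\<in>K. \<forall>y\<in>K. x \<noteq> y \<longrightarrow> open_segment x y \<subseteq> interior K)"

definition D2_billiard_curve :: "(real \<Rightarrow> complex) \<Rightarrow> bool" where
  "D2_billiard_curve g \<longleftrightarrow>
     C2 g \<and> (\<forall>t. vel g t \<noteq> 0) \<and> (\<forall>t. g (t + 1) = g t) \<and> inj_on g {0..<1} \<and>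
     (\<exists>K. compact K \<and> interior K \<noteq> {} \<and> strictly_convex_set K \<and> frontier K = range g) \<and>
     (\<forall>t. g (t + 1/2) = rotR (g t)) \<and> (\<forall>t. g (- t) = reflS (g t))"

text \<open>A lift x of a billiard sequence: 0 < x(i+1) - x(i) < 1 and the reflection law at every
  point (the sum of the unit vectors towards the previous and next point is normal to the curve).\<close>
definition billiard_lift :: "(real \<Rightarrow> complex) \<Rightarrow> (int \<Rightarrow> real) \<Rightarrow> bool" where
  "billiard_lift g x \<longleftrightarrow>
     (\<forall>i. 0 < x (i + 1) - x i \<and> x (i + 1) - x i < 1) \<and>
     (\<forall>i. (sgn (g (x (i - 1)) - g (x i)) + sgn (g (x (i + 1)) - g (x i))) \<bullet> vel g (x i) = 0)"

definition is_lift_of :: "(real \<Rightarrow> complex) \<Rightarrow> (int \<Rightarrow> real) \<Rightarrow> (int \<Rightarrow> complex) \<Rightarrow> bool" where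
  "is_lift_of g x z \<longleftrightarrow> billiard_lift g x \<and> (\<forall>i. z i = g (x i))"

definition billiard_orbit :: "(real \<Rightarrow> complex) \<Rightarrow> (int \<Rightarrow> complex) \<Rightarrow> bool" where
  "billiard_orbit g z \<longleftrightarrow> (\<exists>x. is_lift_of g x z)"

definition birkhoff :: "(int \<Rightarrow> real) \<Rightarrow> bool" where
  "birkhoff x \<longleftrightarrow> (\<forall>i j l m. x i \<le> x j + of_int l \<longrightarrow> x (i + m) \<le> x (j + m) + of_int l)"

definition rotation_number :: "(int \<Rightarrow> real) \<Rightarrow> real \<Rightarrow> bool" where
  "rotation_number x \<omega> \<longleftrightarrow> ((\<lambda>n::nat. (x (int n) - x 0) / real n) \<longlonglongrightarrow> \<omega>)"

definition min_period :: "(int \<Rightarrow> complex) \<Rightarrow> int \<Rightarrow> bool" where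
  "min_period z p \<longleftrightarrow> 0 < p \<and> (\<forall>i. z (i + p) = z i) \<and>
     (\<forall>q. 0 < q \<and> q < p \<longrightarrow> \<not> (\<forall>i. z (i + q) = z i))"

definition symH :: "(int \<Rightarrow> complex) \<Rightarrow> (complex \<Rightarrow> complex) set" where
  "symH z = {h \<in> D2. (\<exists>k. \<forall>i. h (z i) = z (k + i)) \<or> (\<exists>k. \<forall>i. h (z i) = z (k - i))}"

definition typeI :: "(int \<Rightarrow> complex) \<Rightarrow> int \<Rightarrow> bool" where
  "typeI z p \<longleftrightarrow> symH z = D2 \<and> even p \<and>
     (\<forall>i. rotR (z i) = z (p div 2 + i)) \<and> (\<exists>k. \<forall>i. reflS (z i) = z (k - i))"

definition typeII :: "(int \<Rightarrow> complex) \<Rightarrow> int \<Rightarrow> bool" where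
  "typeII z p \<longleftrightarrow> symH z = D2 \<and> even p \<and>
     (\<exists>k. odd k \<and> (\<forall>i. rotR (z i) = z (k - i))) \<and>
     ((\<forall>i. reflS (z i) = z (p div 2 + i)) \<or> (\<forall>i. (rotR \<circ> reflS) (z i) = z (p div 2 + i)))"

definition typeV :: "(int \<Rightarrow> complex) \<Rightarrow> int \<Rightarrow> bool" where
  "typeV z p \<longleftrightarrow> even p \<and> (\<exists>\<sigma> \<in> {reflS, rotR \<circ> reflS}. symH z = {id, \<sigma>} \<and>
     (\<forall>i. \<sigma> (z i) = z (p div 2 + i)) \<and> (\<exists>k. \<forall>i. \<sigma> (z i) = z (k - i)))"

end

(* Write an orbit as z_i = (-1)^i g(c + V_i), where c is the parameter of Z_0. Consecutive
   points are then at distance |g(c + V_i) + g(c + V_(i+1))|, and the billiard orbits with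
   |V_i| < 1/4 are the stationary sequences of the sum of these lengths. The constants 0 and 1/4
   correspond to the two axes of symmetry. On chains 0 = v_0, v_1, ..., v_n in [0, 1/4] the total
   length plus a boundary term attains a maximum. Injectivity of g and the reflections determine
   the signs of the derivatives at 0 and at 1/4, so the maximiser lies strictly between the two
   axes unless it is 0. The hypothesis on the curvature says that |g|^2 has positive second
   derivative at c, so the chains 0, s, ..., s are longer than 0 once n is large. The three orbit
   types come from three boundary terms, each followed by an odd, periodic or antiperiodic
   extension of the chain to all of Z. A Birkhoff periodic orbit of rotation number 1/2 has
   period 2, so orbits of larger minimal period are not Birkhoff. *)

theory Submission
  imports Defs
begin

section \<open>Constrained maximisers of a chain action\<close>

text \<open>One half of Fermat's rule: at a maximiser that may be the left end of the admissible
  interval, only this sign is forced.\<close>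

lemma max_deriv_nonpos:
  fixes f :: "real \<Rightarrow> real"
  assumes "(f has_real_derivative d) (at t)" "t < r" "\<And>s. t \<le> s \<Longrightarrow> s \<le> r \<Longrightarrow> f s \<le> f t"
  shows "d \<le> 0"
proof (rule ccontr)
  assume "\<not> d \<le> 0"
  then obtain \<delta> where "\<delta> > 0" and \<delta>: "\<And>h. 0 < h \<Longrightarrow> h < \<delta> \<Longrightarrow> f t < f (t + h)"
    using DERIV_pos_inc_right[OF assms(1)] by auto
  define h where "h = min (\<delta> / 2) (r - t)"
  have "0 < h" "h < \<delta>" "t + h \<le> r" using \<open>\<delta> > 0\<close> \<open>t < r\<close> by (auto simp: h_def)
  then show False using \<delta>[of h] assms(3)[of "t + h"] by auto
qed

lemma max_deriv_nonneg:
  fixes f :: "real \<Rightarrow> real"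
  assumes "(f has_real_derivative d) (at t)" "l < t" "\<And>s. l \<le> s \<Longrightarrow> s \<le> t \<Longrightarrow> f s \<le> f t"
  shows "0 \<le> d"
proof (rule ccontr)
  assume "\<not> 0 \<le> d"
  then obtain \<delta> where "\<delta> > 0" and \<delta>: "\<And>h. 0 < h \<Longrightarrow> h < \<delta> \<Longrightarrow> f t < f (t - h)"
    using DERIV_neg_dec_left[OF assms(1)] by auto
  define h where "h = min (\<delta> / 2) (t - l)"
  have "0 < h" "h < \<delta>" "l \<le> t - h" using \<open>\<delta> > 0\<close> \<open>l < t\<close> by (auto simp: h_def)
  then show False using \<delta>[of h] assms(3)[of "t - h"] by auto
qed

text \<open>Tychonoff's theorem makes the product of intervals compact; the singleton factor at
  index 0 pins \<open>v 0\<close>. The action is continuous because it reads only the coordinates up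
  to \<open>n\<close>.\<close>

lemma chain_max_exists:
  fixes F :: "real \<Rightarrow> real \<Rightarrow> real" and e :: "real \<Rightarrow> real"
  assumes contF: "continuous_on UNIV (\<lambda>(a, b). F a b)" and conte: "continuous_on UNIV e"
    and r: "0 \<le> r"
  obtains v :: "nat \<Rightarrow> real" where "v 0 = 0" "\<And>i. v i \<in> {0..r}"
    "\<And>w. w 0 = 0 \<Longrightarrow> (\<And>i. w i \<in> {0..r}) \<Longrightarrow>
       (\<Sum>i<n. F (w i) (w (Suc i))) + e (w n) \<le> (\<Sum>i<n. F (v i) (v (Suc i))) + e (v n)"
proof -
  define K where "K = PiE (UNIV :: nat set) (\<lambda>i. if i = 0 then {0} else {0..r})"
  define W where "W = (\<lambda>v :: nat \<Rightarrow> real. (\<Sum>i<n. F (v i) (v (Suc i))) + e (v n))"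
  have K: "v \<in> K \<longleftrightarrow> v 0 = 0 \<and> (\<forall>i. v i \<in> {0..r})" for v
  proof -
    have "v \<in> K \<longleftrightarrow> (\<forall>i. v i \<in> (if i = 0 then {0} else {0..r}))"
      unfolding K_def by (simp only: PiE_UNIV_domain Pi_iff ball_UNIV)
    also have "\<dots> \<longleftrightarrow> v 0 = 0 \<and> (\<forall>i. v i \<in> {0..r})"
      using r by (metis atLeastAtMost_iff order_refl singleton_iff)
    finally show ?thesis .
  qed
  have "compactin (product_topology (\<lambda>i. euclidean) UNIV) K"
    unfolding K_def compactin_PiE by (simp add: compactin_euclidean_iff)
  then have "compact K" by (simp add: euclidean_product_topology)
  moreover have "(\<lambda>_. 0) \<in> K" using r by (simp add: K)
  moreover have "continuous_on K W"
  proof -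
    have "continuous_on UNIV (\<lambda>v :: nat \<Rightarrow> real. F (v i) (v (Suc i)))" for i
      using continuous_on_compose2[OF contF continuous_on_Pair[OF continuous_on_product_coordinates
            continuous_on_product_coordinates], of i "Suc i"] by simp
    moreover have "continuous_on UNIV (\<lambda>v :: nat \<Rightarrow> real. e (v n))"
      using continuous_on_compose2[OF conte continuous_on_product_coordinates] by simp
    ultimately have "continuous_on UNIV W"
      unfolding W_def by (intro continuous_on_add continuous_on_sum)
    then show ?thesis using continuous_on_subset by blast
  qed
  ultimately obtain v where "v \<in> K" and max: "\<forall>w\<in>K. W w \<le> W v"
    using continuous_attains_sup[of K W] by blast
  show thesis
  proof (rule that)
    show "v 0 = 0" "v i \<in> {0..r}" for i using \<open>v \<in> K\<close> by (simp_all only: K)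
    show "(\<Sum>i<n. F (w i) (w (Suc i))) + e (w n) \<le> (\<Sum>i<n. F (v i) (v (Suc i))) + e (v n)"
      if "w 0 = 0" "\<And>i. w i \<in> {0..r}" for w
      using max that unfolding K Ball_def W_def by simp
  qed
qed

text \<open>Only the two links at index \<open>i\<close> see \<open>v i\<close>, so the rest of the
  sum cancels. At the last index \<open>e\<close> replaces the right link.\<close>

lemma chain_max_local:
  fixes F :: "real \<Rightarrow> real \<Rightarrow> real" and e :: "real \<Rightarrow> real" and v :: "nat \<Rightarrow> real"
  assumes i: "1 \<le> i" "i \<le> n"
    and le: "(\<Sum>j<n. F ((v(i := t)) j) ((v(i := t)) (Suc j))) + e ((v(i := t)) n)
          \<le> (\<Sum>j<n. F (v j) (v (Suc j))) + e (v n)"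
  shows "F (v (i - 1)) t + (if i < n then F t (v (Suc i)) else e t)
       \<le> F (v (i - 1)) (v i) + (if i < n then F (v i) (v (Suc i)) else e (v i))"
proof -
  define w where "w = v(i := t)"
  obtain k where k: "i = Suc k" using i by (cases i) auto
  show ?thesis
  proof (cases "i < n")
    case True
    have split: "{..<n} = insert k (insert i ({..<n} - {k, i}))" using i k True by auto
    have eq: "(\<Sum>j<n. F (u j) (u (Suc j)))
        = F (u k) (u i) + F (u i) (u (Suc i)) + (\<Sum>j\<in>{..<n} - {k, i}. F (u j) (u (Suc j)))" for u
      by (subst split) (simp add: k)
    have "(\<Sum>j\<in>{..<n} - {k, i}. F (w j) (w (Suc j))) = (\<Sum>j\<in>{..<n} - {k, i}. F (v j) (v (Suc j)))"
      by (rule sum.cong) (auto simp: w_def k)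
    then show ?thesis using le True unfolding w_def[symmetric] eq by (simp add: w_def k)
  next
    case False
    then have n: "n = Suc k" using i k by simp
    have "(\<Sum>j<k. F (w j) (w (Suc j))) = (\<Sum>j<k. F (v j) (v (Suc j)))"
      by (rule sum.cong) (auto simp: w_def k)
    then show ?thesis using le unfolding w_def[symmetric] n by (simp add: w_def k)
  qed
qed

text \<open>The sign conditions on \<open>D 0\<close> and \<open>D r\<close> say that the constant sequences \<open>0\<close> and \<open>r\<close>
  act as strict barriers, so a maximiser of the action among the sequences between them touches
  neither unless it vanishes identically. Comparison with \<open>0, s, s, \<dots>, s\<close> excludes the latter.\<close>

lemma chain_critical_point:
  fixes F D :: "real \<Rightarrow> real \<Rightarrow> real" and e e' :: "real \<Rightarrow> real" and v :: "nat \<Rightarrow> real"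
  assumes contF: "continuous_on UNIV (\<lambda>(a, b). F a b)" and conte: "continuous_on UNIV e"
    and symF: "\<And>a b. F a b = F b a"
    and dF: "\<And>a b. a \<in> {0..r} \<Longrightarrow> b \<in> {0..r} \<Longrightarrow> ((\<lambda>t. F t b) has_real_derivative D a b) (at a)"
    and de: "\<And>a. a \<in> {0..r} \<Longrightarrow> (e has_real_derivative e' a) (at a)"
    and D0: "D 0 0 = 0" "\<And>b. 0 < b \<Longrightarrow> b \<le> r \<Longrightarrow> 0 < D 0 b"
    and Dr: "D r r = 0" "\<And>b. 0 \<le> b \<Longrightarrow> b < r \<Longrightarrow> D r b < 0"
    and e': "0 \<le> e' 0" "e' r \<le> 0"
    and s: "0 < s" "s \<le> r" "F 0 0 < F s s"
  shows "\<exists>n0. \<forall>n\<ge>n0. \<exists>v :: nat \<Rightarrow> real. v 0 = 0 \<and> (\<forall>i\<in>{1..n}. 0 < v i \<and> v i < r) \<and>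
    (\<forall>i\<in>{1..n}. D (v i) (v (i - 1)) + (if i < n then D (v i) (v (Suc i)) else e' (v i)) = 0)"
proof -
  define \<delta> where "\<delta> = F s s - F 0 0"
  have \<delta>: "\<delta> > 0" using s by (simp add: \<delta>_def)
  \<comment> \<open>\<open>\<delta>\<close> is the gain of a link at height \<open>s\<close> over
    one at height 0. \<open>N\<close> such links outweigh the cost of the jump from 0 to
    \<open>s\<close> and of the changed boundary term.\<close>
  obtain N :: nat where N: "(F 0 0 + e 0 - F 0 s - e s) / \<delta> < real N"
    using reals_Archimedean2 by blast
  show ?thesis
  proof (intro exI[of _ "Suc N"] allI impI)
    fix n assume n: "Suc N \<le> n"
    define W where "W = (\<lambda>v :: nat \<Rightarrow> real. (\<Sum>i<n. F (v i) (v (Suc i))) + e (v n))"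
    have r: "0 \<le> r" using s by simp
    obtain v where v0: "v 0 = 0" and vr: "\<And>i. v i \<in> {0..r}"
      and max: "\<And>w. w 0 = 0 \<Longrightarrow> (\<And>i. w i \<in> {0..r}) \<Longrightarrow> W w \<le> W v"
      using chain_max_exists[OF contF conte r, of n] unfolding W_def by metis
    \<comment> \<open>\<open>E i\<close> is the partial derivative of the action in coordinate
      \<open>i\<close>, and \<open>\<psi> i\<close> the part of the action that depends on
      it.\<close>
    define E where "E i = D (v i) (v (i - 1)) + (if i < n then D (v i) (v (Suc i)) else e' (v i))" for i
    define \<psi> where "\<psi> i t = F (v (i - 1)) t + (if i < n then F t (v (Suc i)) else e t)" for i t
    have \<psi>max: "\<psi> i t \<le> \<psi> i (v i)" if "i \<in> {1..n}" "t \<in> {0..r}" for i t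
      using chain_max_local[of i n F v t e] max[of "v(i := t)"] that v0 vr
      unfolding \<psi>_def W_def by auto
    have \<psi>d: "(\<psi> i has_real_derivative E i) (at (v i))" for i
    proof -
      have "((\<lambda>t. F (v (i - 1)) t) has_real_derivative D (v i) (v (i - 1))) (at (v i))"
        using dF[OF vr[of i] vr[of "i - 1"]] unfolding symF[of "v (i - 1)"] .
      then show ?thesis
        unfolding \<psi>_def[abs_def] E_def using dF[OF vr[of i] vr[of "Suc i"]] de[OF vr[of i]] by (simp add: DERIV_add)
    qed
    have Ele: "E i \<le> 0" if "i \<in> {1..n}" "v i < r" for i
      using max_deriv_nonpos[OF \<psi>d that(2)] \<psi>max[OF that(1)] vr[of i] by (meson atLeastAtMost_iff order_trans)
    have Ege: "0 \<le> E i" if "i \<in> {1..n}" "0 < v i" for i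
      using max_deriv_nonneg[OF \<psi>d that(2)] \<psi>max[OF that(1)] vr[of i] by (meson atLeastAtMost_iff order_trans)
    have D0': "0 \<le> D 0 b" "D 0 b = 0 \<Longrightarrow> b = 0" if "b \<in> {0..r}" for b
      using D0(1) D0(2)[of b] that by (cases "b = 0"; simp)+
    have Dr': "D r b \<le> 0" "D r b = 0 \<Longrightarrow> b = r" if "b \<in> {0..r}" for b
      using Dr(1) Dr(2)[of b] that by (cases "b = r"; simp)+
    \<comment> \<open>Maximality at the lower barrier gives \<open>E i \<le> 0\<close>, while every
      summand is nonnegative. So all vanish, and strictness puts the neighbours at 0.\<close>
    have zero: "v (i - 1) = 0 \<and> (i < n \<longrightarrow> v (Suc i) = 0)" if i: "i \<in> {1..n}" "v i = 0" for i
    proof -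
      have "v i < r" using i(2) s by simp
      then have "D 0 (v (i - 1)) + (if i < n then D 0 (v (Suc i)) else e' 0) \<le> 0"
        using Ele[OF i(1)] unfolding E_def i(2) by blast
      then have "D 0 (v (i - 1)) = 0" "i < n \<Longrightarrow> D 0 (v (Suc i)) = 0"
        using D0'(1)[OF vr[of "i - 1"]] D0'(1)[OF vr[of "Suc i"]] e'(1) by (cases "i < n"; simp)+
      then show ?thesis using D0'(2)[OF vr] by blast
    qed
    \<comment> \<open>The mirror image at the upper barrier: the value \<open>r\<close> would travel
      along left neighbours down to \<open>v 0 = 0\<close>.\<close>
    have top: "v (i - 1) = r" if i: "i \<in> {1..n}" "v i = r" for i
    proof -
      have "0 < v i" using i(2) s by simp
      then have "0 \<le> D r (v (i - 1)) + (if i < n then D r (v (Suc i)) else e' r)"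
        using Ege[OF i(1)] unfolding E_def i(2) by blast
      then have "D r (v (i - 1)) = 0"
        using Dr'(1)[OF vr[of "i - 1"]] Dr'(1)[OF vr[of "Suc i"]] e'(2) by (cases "i < n"; simp)
      then show ?thesis using Dr'(2)[OF vr] by blast
    qed
    have "v i \<noteq> r" if "i \<le> n" for i
      using that
    proof (induction i)
      case 0
      then show ?case using v0 s by simp
    next
      case (Suc i)
      then show ?case using top[of "Suc i"] by auto
    qed
    moreover have "v i \<noteq> 0" if i: "i \<in> {1..n}" for i
    proof
      assume vi: "v i = 0"
      \<comment> \<open>One zero spreads in both directions, so the whole maximiser would vanish and
        lose to \<open>w\<close>, which has \<open>n - 1\<close> links at height
        \<open>s\<close>.\<close>
      have up: "i + k \<le> n \<Longrightarrow> v (i + k) = 0" for k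
      proof (induction k)
        case (Suc k)
        then show ?case using zero[of "i + k"] i by simp
      qed (use vi in simp)
      have down: "v (i - k) = 0" if "k \<le> i" for k
        using that
      proof (induction k)
        case (Suc k)
        then have "i - k \<in> {1..n}" "v (i - k) = 0" using i by auto
        then show ?case using zero[of "i - k"] by simp
      qed (use vi in simp)
      have "v j = 0" if "j \<le> n" for j
        using up[of "j - i"] down[of "i - j"] that by (cases "i \<le> j") auto
      then have "W v = real n * F 0 0 + e 0" unfolding W_def by simp
      moreover define w where "w i = (if i = 0 then 0 else s)" for i :: nat
      obtain k where k: "n = Suc k" "N \<le> k" using n by (cases n) auto
      have "W w = F 0 s + real k * F s s + e s"
        unfolding W_def k by (subst sum.lessThan_Suc_shift) (simp add: w_def)
      moreover have "W w \<le> W v" using max[of w] s by (simp add: w_def)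
      ultimately have "real k * \<delta> \<le> F 0 0 + e 0 - F 0 s - e s"
        using k by (simp add: \<delta>_def algebra_simps)
      moreover have "F 0 0 + e 0 - F 0 s - e s < real k * \<delta>"
      proof -
        have "F 0 0 + e 0 - F 0 s - e s < real N * \<delta>" using N \<delta> by (simp add: pos_divide_less_eq)
        also have "\<dots> \<le> real k * \<delta>" using k(2) \<delta> by simp
        finally show ?thesis .
      qed
      ultimately show False by simp
    qed
    ultimately have pos: "0 < v i \<and> v i < r" if "i \<in> {1..n}" for i
      using vr[of i] that by (simp add: less_le)
    moreover have "E i = 0" if "i \<in> {1..n}" for i
      using Ele[OF that] Ege[OF that] pos[OF that] by simp
    ultimately show "\<exists>v :: nat \<Rightarrow> real. v 0 = 0 \<and> (\<forall>i\<in>{1..n}. 0 < v i \<and> v i < r) \<and>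
      (\<forall>i\<in>{1..n}. D (v i) (v (i - 1)) + (if i < n then D (v i) (v (Suc i)) else e' (v i)) = 0)"
      using v0 unfolding E_def by blast
  qed
qed

section \<open>Extending a finite chain to the integers\<close>

text \<open>The chain is a fundamental domain: reflection about \<open>m / 2\<close> with sign
  \<open>\<epsilon>\<close> and translation by \<open>m\<close> with factor
  \<open>- \<epsilon>\<close> fill the integers, and together they make \<open>V\<close> odd. For
  \<open>m = 2 * int n\<close> the centre is \<open>n\<close> itself, where
  \<open>v n \<noteq> 0\<close> forces \<open>\<epsilon> = 1\<close>.\<close>

lemma symmetric_extension:
  fixes v :: "nat \<Rightarrow> real" and \<epsilon> :: real
  assumes v0: "v 0 = 0" and v: "\<And>i. i \<in> {1..n} \<Longrightarrow> 0 < v i \<and> v i < r"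
    and \<epsilon>: "\<epsilon> = 1 \<or> \<epsilon> = -1" and n: "0 < n"
    and m: "m = 2 * int n + 1 \<or> m = 2 * int n \<and> \<epsilon> = 1"
  shows "\<exists>V :: int \<Rightarrow> real. (\<forall>i. V (i + m) = - \<epsilon> * V i) \<and> (\<forall>i. V (- i) = - V i) \<and>
    (\<forall>i. V i = 0 \<longleftrightarrow> m dvd i) \<and> (\<forall>i\<le>n. V (int i) = v i) \<and> (\<forall>i. \<bar>V i\<bar> < r)"
proof -
  define W where "W j = (if j \<le> int n then v (nat j) else \<epsilon> * v (nat (m - j)))" for j
  \<comment> \<open>The sign is the power of \<open>- \<epsilon>\<close> with exponent
    \<open>i div m\<close>, which depends only on the parity of the exponent.\<close>
  define V where "V i = (if even (i div m) then 1 else - \<epsilon>) * W (i mod m)" for i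
  have mpos: "0 < m" using m n by auto
  have W0: "W 0 = 0" by (simp add: W_def v0)
  have Wm: "W (m - j) = \<epsilon> * W j" if "0 < j" "j < m" for j
  proof (cases "m = 2 * int n \<and> j = int n")
    case True
    then show ?thesis using m by (auto simp: W_def)
  next
    case False
    then have "m - j \<le> int n \<longleftrightarrow> \<not> j \<le> int n" using m by auto
    then show ?thesis using \<epsilon> by (auto simp: W_def)
  qed
  have Wv: "W j \<noteq> 0 \<and> \<bar>W j\<bar> < r" if "0 < j" "j < m" for j
  proof (cases "j \<le> int n")
    case True
    then have "nat j \<in> {1..n}" using that by auto
    then show ?thesis using v[of "nat j"] True by (simp add: W_def)
  next
    case False
    then have "nat (m - j) \<in> {1..n}" using that m by auto
    then show ?thesis using v[of "nat (m - j)"] False \<epsilon> by (auto simp: W_def)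
  qed
  have r: "0 < r" using v[of 1] n by auto
  have Vm: "V (i + m) = - \<epsilon> * V i" for i
    using mpos \<epsilon> by (auto simp: V_def)
  have zero: "V i = 0 \<longleftrightarrow> m dvd i" for i
    using Wv[of "i mod m"] pos_mod_bound[OF mpos, of i] pos_mod_sign[OF mpos, of i] W0 \<epsilon>
    by (cases "i mod m = 0") (auto simp: V_def dvd_eq_mod_eq_0)
  have bound: "\<bar>V i\<bar> < r" for i
    using Wv[of "i mod m"] pos_mod_bound[OF mpos, of i] pos_mod_sign[OF mpos, of i] W0 \<epsilon> r
    by (cases "i mod m = 0") (auto simp: V_def)
  have odd: "V (- i) = - V i" for i
  proof (cases "i mod m = 0")
    case True
    then have "m dvd i" by auto
    then show ?thesis using zero[of i] zero[of "- i"] by simp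
  next
    case False
    then have "(- i) mod m = m - i mod m" "(- i) div m = - (i div m) - 1"
      using mpos by (simp_all add: zmod_zminus1_eq_if zdiv_zminus1_eq_if)
    moreover have "W (m - i mod m) = \<epsilon> * W (i mod m)"
      using Wm False pos_mod_bound[OF mpos, of i] pos_mod_sign[OF mpos, of i] by simp
    ultimately show ?thesis using \<epsilon> by (auto simp: V_def)
  qed
  have "V (int i) = v i" if "i \<le> n" for i
  proof -
    have "int i < m" using that m n by auto
    then show ?thesis using that by (simp add: V_def W_def)
  qed
  then show ?thesis using Vm odd zero bound by blast
qed

section \<open>Derivatives of lengths, and membership in the symmetry group\<close>

lemma has_real_derivative_norm:
  fixes f :: "real \<Rightarrow> 'a :: real_inner"
  assumes "(f has_vector_derivative f') (at t)" "f t \<noteq> 0"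
  shows "((\<lambda>t. norm (f t)) has_real_derivative sgn (f t) \<bullet> f') (at t)"
proof -
  have "((\<lambda>t. norm (f t)) has_derivative (\<lambda>h. (h *\<^sub>R f') \<bullet> sgn (f t))) (at t)"
    using has_derivative_compose[OF assms(1)[unfolded has_vector_derivative_def]
        has_derivative_norm[OF assms(2)]] .
  then show ?thesis
    unfolding has_field_derivative_def 
    by (simp add: inner_commute mult_commute_abs)
qed

lemma has_real_derivative_inner_const:
  fixes f :: "real \<Rightarrow> 'a :: real_inner"
  assumes "(f has_vector_derivative f') (at t)"
  shows "((\<lambda>t. f t \<bullet> u) has_real_derivative f' \<bullet> u) (at t)"
  using bounded_linear.has_vector_derivative[OF bounded_linear_inner_left assms]
  by (simp add: has_real_derivative_iff_has_vector_derivative)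

lemma sgn_inner: "sgn x \<bullet> v = (x \<bullet> v) / norm x" for x v :: "'a :: real_inner"
  by (simp add: sgn_div_norm divide_inverse mult.commute)

lemma symH_shiftI:
  assumes "h \<in> D2" "\<And>i. h (z i) = z (k + i)"
  shows "h \<in> symH z"
  unfolding symH_def using assms by blast

lemma symH_reflectionI:
  assumes "h \<in> D2" "\<And>i. h (z i) = z (k - i)"
  shows "h \<in> symH z"
  unfolding symH_def using assms by blast

lemma symH_imp_ex:
  assumes "h \<in> symH z"
  shows "\<exists>k. h (z 0) = z k"
proof -
  have "(\<exists>k. \<forall>i. h (z i) = z (k + i)) \<or> (\<exists>k. \<forall>i. h (z i) = z (k - i))"
    using assms by (simp add: symH_def)
  then show ?thesis by blast
qed

lemma symH_subset_D2: "symH z \<subseteq> D2"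
  unfolding symH_def by (rule Collect_restrict)

lemma id_in_symH: "id \<in> symH z"
  by (rule symH_shiftI[where k = 0]) (simp_all add: D2_def)

section \<open>Periodicity and injectivity of the curve\<close>

locale billiard_curve =
  fixes g :: "real \<Rightarrow> complex"
  assumes D2: "D2_billiard_curve g"
begin

lemma g_deriv: "(g has_vector_derivative vel g t) (at t)"
  and vel_deriv: "(vel g has_vector_derivative acc g t) (at t)"
proof -
  obtain g1 g2 where g1: "\<And>t. (g has_vector_derivative g1 t) (at t)"
    and g2: "\<And>t. (g1 has_vector_derivative g2 t) (at t)"
    using D2 unfolding D2_billiard_curve_def C2_def by blast
  have "vel g = g1" unfolding vel_def using g1 vector_derivative_at by blast
  then show "(g has_vector_derivative vel g t) (at t)"
    and "(vel g has_vector_derivative acc g t) (at t)"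
    using g1 g2[of t] by (simp_all add: acc_def vector_derivative_at[OF g2])
qed

lemma vel_nonzero: "vel g t \<noteq> 0"
  using D2 unfolding D2_billiard_curve_def by blast

lemma g_half: "g (t + 1/2) = - g t"
  using D2 unfolding D2_billiard_curve_def rotR_def by blast

lemma g_cnj: "g (- t) = cnj (g t)"
  using D2 unfolding D2_billiard_curve_def reflS_def by blast

lemma g_int: "g (t + of_int k) = g t"
proof -
  have "g (t + 1) = g t" for t
    using D2 unfolding D2_billiard_curve_def by blast
  then have nat: "g (t + real n) = g t" for t n
    by (induction n) (simp_all add: add.assoc[symmetric] add.commute[of 1])
  show ?thesis
    using nat[of t "nat k"] nat[of "t + of_int k" "nat (- k)"] by (cases "0 \<le> k") simp_all
qed

lemma g_eq_iff: "g s = g t \<longleftrightarrow> s - t \<in> \<int>"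
proof
  assume "g s = g t"
  moreover have "g (frac u) = g u" for u
    using g_int[of "frac u" "\<lfloor>u\<rfloor>"] by (simp add: frac_def)
  moreover have "inj_on g {0..<1}"
    using D2 unfolding D2_billiard_curve_def by blast
  ultimately have "frac s = frac t"
    by (intro inj_onD[of g "{0..<1}"]) (simp_all add: frac_lt_1)
  then have "s - t = of_int (\<lfloor>s\<rfloor> - \<lfloor>t\<rfloor>)" by (simp add: frac_def)
  then show "s - t \<in> \<int>" by simp
next
  assume "s - t \<in> \<int>"
  then obtain k where "s = t + of_int k" by (metis Ints_cases add.commute diff_add_cancel)
  then show "g s = g t" by (simp add: g_int)
qed

text \<open>By central symmetry a passage through the origin would recur half a period later,
  against injectivity.\<close>

lemma g_nonzero: "g t \<noteq> 0"
proof
  assume "g t = 0"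
  then have "g (t + 1/2) = g t" using g_half[of t] by simp
  then have "(1/2 :: real) \<in> \<int>" by (simp add: g_eq_iff)
  then show False by (auto elim!: Ints_cases)
qed

lemma g_shift_deriv: "((\<lambda>s. g (a + s)) has_vector_derivative vel g (a + t)) (at t)"
  using vector_diff_chain_at[of "\<lambda>s. a + s" 1 t g "vel g (a + t)"] g_deriv
  by (simp add: o_def has_vector_derivative_add_const has_vector_derivative_id add.commute[of a])

lemma vel_half: "vel g (t + 1/2) = - vel g t"
proof -
  have "((\<lambda>s. g (s + 1/2)) has_vector_derivative vel g (t + 1/2)) (at t)"
    using g_shift_deriv[of "1/2"] by (simp add: add.commute)
  moreover have "((\<lambda>s. g (s + 1/2)) has_vector_derivative - vel g t) (at t)"
    unfolding g_half by (intro has_vector_derivative_minus g_deriv)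
  ultimately show ?thesis by (rule vector_derivative_unique_at)
qed

lemma g_half_int: "g (t + of_int i / 2) = (if even i then g t else - g t)"
  and vel_half_int: "vel g (t + of_int i / 2) = (if even i then vel g t else - vel g t)"
proof -
  have vel_int: "vel g (t + of_int k) = vel g t" for t k
  proof -
    have "((\<lambda>s. g (s + of_int k)) has_vector_derivative vel g (t + of_int k)) (at t)"
      using g_shift_deriv[of "of_int k"] by (simp add: add.commute)
    then show ?thesis unfolding g_int using g_deriv vector_derivative_unique_at by blast
  qed
  show "g (t + of_int i / 2) = (if even i then g t else - g t)"
  proof (cases "even i")
    case True
    then show ?thesis using g_int by (auto elim!: evenE)
  next
    case False
    then obtain k where "i = 2 * k + 1" by (rule oddE)
    then have "t + of_int i / 2 = (t + of_int k) + 1/2" by (simp add: field_simps)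
    then show ?thesis using False g_int by (simp only: g_half) simp
  qed
  show "vel g (t + of_int i / 2) = (if even i then vel g t else - vel g t)"
  proof (cases "even i")
    case True
    then show ?thesis using vel_int by (auto elim!: evenE)
  next
    case False
    then obtain k where "i = 2 * k + 1" by (rule oddE)
    then have "t + of_int i / 2 = (t + of_int k) + 1/2" by (simp add: field_simps)
    then show ?thesis using False vel_int by (simp only: vel_half) simp
  qed
qed

end

section \<open>A curve point on an axis of symmetry\<close>

text \<open>At \<open>t = 0\<close> the condition \<open>refl\<close> puts \<open>g c\<close> on the
  fixed line of \<open>\<sigma>\<close>. Keeping \<open>\<sigma>\<close> abstract lets the same
  facts serve both axes, via \<open>axis_quarter\<close>.\<close>

locale axis_curve = billiard_curve +
  fixes c :: real and \<sigma> :: "complex \<Rightarrow> complex"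
  assumes \<sigma>: "\<sigma> \<in> {reflS, rotR \<circ> reflS}"
    and refl: "\<And>t. g (c - t) = \<sigma> (g (c + t))"
begin

lemma \<sigma>_cases: "\<sigma> = cnj \<or> \<sigma> = (\<lambda>y. - cnj y)"
  using \<sigma> by (auto simp: fun_eq_iff reflS_def rotR_def)

lemma \<sigma>_minus: "\<sigma> (- y) = - \<sigma> y"
  using \<sigma>_cases by auto

lemma \<sigma>_add: "\<sigma> (x + y) = \<sigma> x + \<sigma> y"
  using \<sigma>_cases by auto

lemma \<sigma>_inner: "\<sigma> x \<bullet> \<sigma> y = x \<bullet> y"
  using \<sigma>_cases by (auto simp: inner_complex_def)

lemma \<sigma>_linear: "bounded_linear \<sigma>"
  using \<sigma>_cases bounded_linear_cnj bounded_linear_minus[OF bounded_linear_cnj] by auto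

lemma \<sigma>_sgn: "\<sigma> (sgn y) = sgn (\<sigma> y)"
  using \<sigma>_cases by (auto simp: sgn_div_norm)

lemma D2_eq: "D2 = {id, rotR, \<sigma>, rotR \<circ> \<sigma>}"
proof -
  have "rotR \<circ> (rotR \<circ> reflS) = reflS" by (simp add: fun_eq_iff rotR_def)
  then show ?thesis using \<sigma> by (auto simp: D2_def)
qed

lemma vel_refl: "vel g (c - t) = - \<sigma> (vel g (c + t))"
proof -
  have "((\<lambda>s. g (c - s)) has_vector_derivative \<sigma> (vel g (c + t))) (at t)"
    unfolding refl by (rule bounded_linear.has_vector_derivative[OF \<sigma>_linear g_shift_deriv])
  moreover have "((\<lambda>s. c - s) has_vector_derivative -1) (at t)"
    by (auto intro!: derivative_eq_intros)
  from vector_diff_chain_at[OF this g_deriv]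
  have "((\<lambda>s. g (c - s)) has_vector_derivative - vel g (c - t)) (at t)"
    by (simp add: o_def)
  ultimately show ?thesis
    by (metis vector_derivative_unique_at minus_minus)
qed

lemma \<sigma>_vel: "\<sigma> (vel g c) = - vel g c"
  using arg_cong[OF vel_refl[of 0], of uminus] by simp

text \<open>\<open>\<sigma>\<close> is a reflection that negates \<open>vel g c\<close>, so its
  fixed line is orthogonal to that vector.\<close>

lemma \<sigma>_fixed_iff: "\<sigma> y = y \<longleftrightarrow> y \<bullet> vel g c = 0"
  using \<sigma>_cases \<sigma>_vel vel_nonzero[of c]
  by (auto simp: inner_complex_def complex_eq_iff)

lemma g_inner_vel: "g c \<bullet> vel g c = 0"
  using refl[of 0] by (simp add: \<sigma>_fixed_iff[symmetric])

text \<open>A zero of the inner product at \<open>t\<close> means that \<open>\<sigma>\<close> fixes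
  \<open>g (c + t)\<close>, so \<open>g (c - t) = g (c + t)\<close> and \<open>2 * t\<close> is an
  integer by injectivity. Hence the positive sign given by the derivative at 0 persists up to
  1/2.\<close>

lemma g_inner_vel_pos:
  assumes "0 < a" "a < 1/2"
  shows "0 < g (c + a) \<bullet> vel g c"
proof (rule ccontr)
  assume neg: "\<not> ?thesis"
  define \<phi> where "\<phi> s = g (c + s) \<bullet> vel g c" for s
  have \<phi>': "(\<phi> has_real_derivative vel g (c + s) \<bullet> vel g c) (at s)" for s
    unfolding \<phi>_def[abs_def] by (rule has_real_derivative_inner_const[OF g_shift_deriv])
  have "0 < vel g (c + 0) \<bullet> vel g c" using vel_nonzero by simp
  then obtain d where d: "0 < d" "\<And>h. 0 < h \<Longrightarrow> h < d \<Longrightarrow> \<phi> 0 < \<phi> (0 + h)"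
    using DERIV_pos_inc_right[OF \<phi>'] by blast
  define h where "h = min (d / 2) a"
  have h: "0 < h" "h < d" "h \<le> a" using d assms by (auto simp: h_def)
  have "0 < \<phi> h" using d(2)[OF h(1,2)] g_inner_vel by (simp add: \<phi>_def)
  moreover have "\<phi> a \<le> 0" using neg by (simp add: \<phi>_def)
  moreover have "continuous_on {h..a} \<phi>"
    using \<phi>' by (meson DERIV_isCont continuous_at_imp_continuous_on)
  ultimately obtain t where t: "h \<le> t" "t \<le> a" "\<phi> t = 0"
    using IVT2'[of \<phi> a 0 h] h by auto
  then have "g (c - t) = g (c + t)" unfolding refl \<sigma>_fixed_iff \<phi>_def by simp
  then have "(c + t) - (c - t) \<in> \<int>" by (metis g_eq_iff)
  then obtain k :: int where "2 * t = of_int k" by (auto elim: Ints_cases)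
  moreover have "0 < 2 * t" "2 * t < 1" using t h assms by auto
  ultimately have "0 < k" "k < 1" by (metis of_int_0_less_iff, metis of_int_less_1_iff)
  then show False by simp
qed

lemma g_inner_vel_neg:
  assumes "0 < a" "a < 1/2"
  shows "g (c - a) \<bullet> vel g c < 0"
proof -
  have "g (c - a) \<bullet> vel g c = - (\<sigma> (g (c + a)) \<bullet> \<sigma> (vel g c))"
    by (simp add: refl \<sigma>_vel)
  then show ?thesis using g_inner_vel_pos[OF assms] by (simp add: \<sigma>_inner)
qed

text \<open>The reversal of parameters about \<open>c\<close>, followed by the half turn, fixes the
  parameters \<open>c + 1/4\<close> and \<open>c - 1/4\<close> modulo 1.\<close>

lemma axis_quarter:
  "axis_curve g (c + 1/4) (rotR \<circ> \<sigma>)" "axis_curve g (c - 1/4) (rotR \<circ> \<sigma>)"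
proof -
  have "rotR \<circ> (rotR \<circ> reflS) = reflS" by (simp add: fun_eq_iff rotR_def)
  then have \<sigma>': "rotR \<circ> \<sigma> \<in> {reflS, rotR \<circ> reflS}" using \<sigma> by auto
  have "g (c + 1/4 - t) = rotR (\<sigma> (g (c + 1/4 + t)))"
    and "g (c - 1/4 - t) = rotR (\<sigma> (g (c - 1/4 + t)))" for t
  proof -
    have "g (c + 1/4 - t) = \<sigma> (g (c - 1/4 + t))" "g (c - 1/4 - t) = \<sigma> (g (c + 1/4 + t))"
      using refl[of "t - 1/4"] refl[of "t + 1/4"] by (simp_all add: algebra_simps)
    moreover have "g (c + 1/4 + t) = - g (c - 1/4 + t)"
      using g_half[of "c - 1/4 + t"] by (simp add: algebra_simps)
    ultimately show "g (c + 1/4 - t) = rotR (\<sigma> (g (c + 1/4 + t)))"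
      and "g (c - 1/4 - t) = rotR (\<sigma> (g (c - 1/4 + t)))"
      by (simp_all add: rotR_def \<sigma>_minus)
  qed
  then show "axis_curve g (c + 1/4) (rotR \<circ> \<sigma>)" "axis_curve g (c - 1/4) (rotR \<circ> \<sigma>)"
    using \<sigma>' by unfold_locales simp_all
qed

text \<open>The squared norm of \<open>g (c + s)\<close> is stationary at \<open>s = 0\<close>. In
  its second derivative the curvature term \<open>g c \<bullet> acc g c\<close> has size
  \<open>cmod (g c) * curvature g c\<close> times the squared speed, less than the squared speed by
  hypothesis.\<close>

lemma longer_chord:
  assumes "curvature g c * (2 * cmod (g c)) < 2"
  obtains s where "0 < s" "s \<le> 1/4" "cmod (g c) < cmod (g (c + s))"
proof -
  define \<phi> where "\<phi> s = g (c + s) \<bullet> g (c + s)" for s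
  define \<psi> where "\<psi> s = 2 * (g (c + s) \<bullet> vel g (c + s))" for s
  have vel_shift: "((\<lambda>s. vel g (c + s)) has_vector_derivative acc g (c + t)) (at t)" for t
    using vector_diff_chain_at[of "\<lambda>s. c + s" 1 t "vel g" "acc g (c + t)"] vel_deriv
    by (simp add: o_def has_vector_derivative_add_const has_vector_derivative_id add.commute[of c])
  note inner_deriv = bounded_bilinear.has_vector_derivative[OF bounded_bilinear_inner]
  have \<phi>': "(\<phi> has_real_derivative \<psi> s) (at s)" for s
    using inner_deriv[OF g_shift_deriv[of c s] g_shift_deriv[of c s]]
    unfolding \<phi>_def[abs_def] \<psi>_def has_real_derivative_iff_has_vector_derivative
    by (simp add: inner_commute)
  have \<psi>': "(\<psi> has_real_derivative 2 * (vel g c \<bullet> vel g c + g c \<bullet> acc g c)) (at 0)"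
    using DERIV_cmult[OF inner_deriv[OF g_shift_deriv[of c 0] vel_shift[of 0],
          unfolded has_real_derivative_iff_has_vector_derivative[symmetric]], of 2]
    unfolding \<psi>_def[abs_def] by (simp add: add.commute)
  define v where "v = cmod (vel g c)"
  have v: "0 < v" using vel_nonzero by (simp add: v_def)
  \<comment> \<open>The vectors \<open>g c\<close> and \<open>vel g c\<close> lie on different
    coordinate axes. So \<open>g c\<close> is normal to the curve, and its inner product with
    \<open>acc g c\<close> is, up to sign and scale, the determinant in
    \<open>curvature\<close>.\<close>
  have "(Re (vel g c) = 0 \<and> Im (g c) = 0) \<or> (Im (vel g c) = 0 \<and> Re (g c) = 0)"
    using \<sigma>_cases \<sigma>_vel g_inner_vel vel_nonzero[of c]
    by (auto simp: complex_eq_iff inner_complex_def)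
  then have "\<bar>g c \<bullet> acc g c\<bar> * v = cmod (g c) * \<bar>Im (cnj (vel g c) * acc g c)\<bar>"
    by (auto simp: v_def inner_complex_def abs_mult cmod_def)
  also have "\<dots> < v ^ 3"
    using assms v by (simp add: curvature_def v_def field_simps)
  finally have "\<bar>g c \<bullet> acc g c\<bar> < v ^ 2"
    using v by (simp add: power3_eq_cube power2_eq_square)
  then have "0 < 2 * (vel g c \<bullet> vel g c + g c \<bullet> acc g c)"
    by (simp add: v_def power2_norm_eq_inner)
  then obtain d where d: "0 < d" "\<And>h. 0 < h \<Longrightarrow> h < d \<Longrightarrow> \<psi> 0 < \<psi> (0 + h)"
    using DERIV_pos_inc_right[OF \<psi>'] by blast
  have "\<psi> 0 = 0" using g_inner_vel by (simp add: \<psi>_def)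
  define s where "s = min (d / 2) (1/4)"
  have s: "0 < s" "s < d" "s \<le> 1/4" using d by (auto simp: s_def)
  then obtain t where t: "0 < t" "t < s" "\<phi> s - \<phi> 0 = (s - 0) * \<psi> t"
    using MVT2[of 0 s \<phi> \<psi>] \<phi>' by blast
  moreover have "0 < s * \<psi> t" using d(2)[of t] s t \<open>\<psi> 0 = 0\<close> by simp
  ultimately have "\<phi> 0 < \<phi> s" by simp
  then have "cmod (g c) < cmod (g (c + s))"
    by (simp add: \<phi>_def norm_lt)
  then show thesis using that s by blast
qed

section \<open>Chord lengths and their critical chains\<close>

text \<open>As \<open>g (t + 1/2) = - g t\<close>, this is the distance of the curve points with
  parameters \<open>c + a\<close> and \<open>c + b + 1/2\<close>.\<close>

definition chord :: "real \<Rightarrow> real \<Rightarrow> real" where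
  "chord a b = norm (g (c + a) + g (c + b))"

definition dchord :: "real \<Rightarrow> real \<Rightarrow> real" where
  "dchord a b = sgn (g (c + a) + g (c + b)) \<bullet> vel g (c + a)"

text \<open>A vanishing chord would identify the points at \<open>c + a\<close> and
  \<open>c + b + 1/2\<close>, whose parameters differ by a number strictly between -1 and 0.\<close>

lemma chord_nonzero:
  assumes "\<bar>a - b\<bar> < 1/2"
  shows "g (c + a) + g (c + b) \<noteq> 0"
proof
  assume "g (c + a) + g (c + b) = 0"
  then have "g (c + a) = g (c + b + 1/2)"
    unfolding g_half by (simp add: eq_neg_iff_add_eq_0)
  then have "a - b - 1/2 \<in> \<int>" by (simp add: g_eq_iff algebra_simps)
  then obtain k :: int where k: "a - b - 1/2 = of_int k" by (auto elim: Ints_cases)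
  moreover have "-1 < a - b - 1/2" "a - b - 1/2 < 0" using assms by linarith+
  ultimately have "real_of_int (-1) < of_int k" "real_of_int k < of_int 0" by simp_all
  then have "-1 < k" "k < 0" by (simp_all only: of_int_less_iff)
  then show False by simp
qed

lemma chord_deriv:
  assumes "\<bar>a - b\<bar> < 1/2"
  shows "((\<lambda>t. chord t b) has_real_derivative dchord a b) (at a)"
proof -
  have "((\<lambda>t. g (c + t) + g (c + b)) has_vector_derivative vel g (c + a)) (at a)"
    using has_vector_derivative_add[OF g_shift_deriv has_vector_derivative_const] by simp
  from has_real_derivative_norm[OF this chord_nonzero[OF assms]]
  show ?thesis by (simp add: chord_def dchord_def)
qed

lemma dchord_minus: "dchord (- a) (- b) = - dchord a b"
proof -
  have "g (c + - t) = \<sigma> (g (c + t))" "vel g (c + - t) = - \<sigma> (vel g (c + t))" for t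
    using refl vel_refl by simp_all
  then show ?thesis
    unfolding dchord_def by (simp add: \<sigma>_add[symmetric] \<sigma>_sgn[symmetric] \<sigma>_inner)
qed

text \<open>The lower barrier: \<open>g c\<close> is orthogonal to \<open>vel g c\<close>, so only
  the point at \<open>c + b\<close> contributes.\<close>

lemma dchord_zero_pos:
  assumes "0 < b" "b \<le> 1/4"
  shows "0 < dchord 0 b"
proof -
  have "g c + g (c + b) \<noteq> 0" using chord_nonzero[of 0 b] assms by simp
  then show ?thesis
    using g_inner_vel_pos[of b] assms
    by (simp add: dchord_def sgn_inner inner_add_left g_inner_vel)
qed

lemma continuous_g: "continuous_on S g"
  using g_deriv has_vector_derivative_continuous continuous_at_imp_continuous_on by blast

text \<open>The upper barrier at 1/4 is the lower one seen from the other axis, which the curve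
  meets at \<open>c + 1/4\<close>. The strict gain comes from \<open>longer_chord\<close>.\<close>

lemma critical_chains:
  fixes e e' :: "real \<Rightarrow> real"
  assumes ell: "curvature g c * (2 * cmod (g c)) < 2"
    and conte: "continuous_on UNIV e"
    and de: "\<And>a. a \<in> {0..1/4} \<Longrightarrow> (e has_real_derivative e' a) (at a)"
    and e': "0 \<le> e' 0" "e' (1/4) \<le> 0"
  shows "\<exists>n0. \<forall>n\<ge>n0. \<exists>v :: nat \<Rightarrow> real. v 0 = 0 \<and> (\<forall>i\<in>{1..n}. 0 < v i \<and> v i < 1/4) \<and>
    (\<forall>i\<in>{1..n}. dchord (v i) (v (i - 1))
       + (if i < n then dchord (v i) (v (Suc i)) else e' (v i)) = 0)"
proof -
  interpret q: axis_curve g "c + 1/4" "rotR \<circ> \<sigma>" by (rule axis_quarter)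
  obtain s where s: "0 < s" "s \<le> 1/4" "cmod (g c) < cmod (g (c + s))"
    using longer_chord[OF ell] .
  have double: "chord t t = 2 * cmod (g (c + t))" for t
    unfolding chord_def by (metis mult_2 norm_mult norm_numeral)
  show ?thesis
  proof (rule chain_critical_point[where F = chord and s = s])
    show "continuous_on UNIV (\<lambda>(a, b). chord a b)"
      unfolding chord_def case_prod_beta
      by (intro continuous_intros continuous_on_compose2[OF continuous_g[of UNIV]]) auto
    show "((\<lambda>t. chord t b) has_real_derivative dchord a b) (at a)"
      if "a \<in> {0..1/4}" "b \<in> {0..1/4}" for a b
    proof (rule chord_deriv)
      show "\<bar>a - b\<bar> < 1/2" using that unfolding atLeastAtMost_iff by linarith
    qed
    show "dchord 0 0 = 0" "dchord (1/4) (1/4) = 0"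
      unfolding dchord_def sgn_inner inner_add_left add_0_right g_inner_vel q.g_inner_vel by simp_all
    show "dchord (1/4) b < 0" if "0 \<le> b" "b < 1/4" for b
    proof -
      have "g (c + 1/4) + g (c + b) \<noteq> 0" using chord_nonzero[of "1/4" b] that by simp
      moreover have "g (c + b) \<bullet> vel g (c + 1/4) < 0"
        using q.g_inner_vel_neg[of "1/4 - b"] that by simp
      ultimately show ?thesis
        by (simp add: dchord_def sgn_inner inner_add_left q.g_inner_vel divide_neg_pos)
    qed
    show "chord a b = chord b a" for a b by (simp add: chord_def add.commute)
  qed (use s conte de e' dchord_zero_pos in \<open>simp_all add: double\<close>)
qed

section \<open>Symmetric stationary sequences\<close>

text \<open>The discrete Euler-Lagrange equation of the total length: the terms are the derivatives
  in \<open>V i\<close> of the two chords that end there.\<close>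

definition stationary :: "(int \<Rightarrow> real) \<Rightarrow> bool" where
  "stationary V \<longleftrightarrow> (\<forall>i. dchord (V i) (V (i - 1)) + dchord (V i) (V (i + 1)) = 0)"

text \<open>Translation by \<open>m\<close> and reversal preserve the equation because
  \<open>dchord\<close> is odd in both arguments jointly. They move every index to 0, where the two
  terms cancel, or into the range from 1 to \<open>n\<close>.\<close>

lemma stationary_extension:
  assumes per: "\<And>i. V (i + m) = - \<epsilon> * V i" and odd: "\<And>i. V (- i) = - V i"
    and \<epsilon>: "\<epsilon> = 1 \<or> \<epsilon> = -1" and m: "0 < m" "m \<le> 2 * n + 1"
    and base: "\<And>i. 1 \<le> i \<Longrightarrow> i \<le> n \<Longrightarrow> dchord (V i) (V (i - 1)) + dchord (V i) (V (i + 1)) = 0"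
  shows "stationary V"
proof -
  define P where "P i \<longleftrightarrow> dchord (V i) (V (i - 1)) + dchord (V i) (V (i + 1)) = 0" for i
  have Pper: "P (i + m) \<longleftrightarrow> P i" for i
  proof -
    have "V (i + m - 1) = - \<epsilon> * V (i - 1)" "V (i + m + 1) = - \<epsilon> * V (i + 1)"
      using per[of "i - 1"] per[of "i + 1"] by (simp_all add: algebra_simps)
    then show ?thesis
      unfolding P_def per using \<epsilon> dchord_minus[of "V i" "V (i - 1)"] dchord_minus[of "V i" "V (i + 1)"]
      by auto
  qed
  have Podd: "P (- i) \<longleftrightarrow> P i" for i
  proof -
    have "V (- i - 1) = - V (i + 1)" "V (- i + 1) = - V (i - 1)"
      using odd[of "i + 1"] odd[of "i - 1"] by simp_all
    then show ?thesis unfolding P_def odd by (simp add: dchord_minus) argo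
  qed
  have "V 0 = 0" using odd[of 0] by simp
  then have P0: "P 0"
    using odd[of 1] dchord_minus[of 0 "V 1"] by (simp add: P_def)
  have Pmult: "P (i + k * m) \<longleftrightarrow> P i" for i k
  proof (induction k rule: int_induct[where k = 0])
    case (step1 k)
    then show ?case using Pper[of "i + k * m"] by (simp add: algebra_simps)
  next
    case (step2 k)
    then show ?case using Pper[of "i + (k - 1) * m"] by (simp add: algebra_simps)
  qed simp
  have "P i" for i
  proof -
    define j where "j = i mod m"
    have j: "0 \<le> j" "j < m" using m by (simp_all add: j_def)
    \<comment> \<open>Since \<open>m \<le> 2 * n + 1\<close>, a residue \<open>j\<close> above
      \<open>n\<close> has \<open>m - j \<le> n\<close>.\<close>
    consider "j = 0" | "1 \<le> j" "j \<le> n" | "1 \<le> m - j" "m - j \<le> n" using j m by linarith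
    then have "P j"
    proof cases
      case 3
      then have "P (m - j)" using base unfolding P_def by blast
      then show ?thesis using Pper[of "- j"] Podd[of j] by (simp add: algebra_simps)
    qed (use P0 base in \<open>auto simp: P_def\<close>)
    then show ?thesis using Pmult[of j "i div m"] by (simp add: j_def add.commute)
  qed
  then show ?thesis unfolding stationary_def P_def by blast
qed

text \<open>With \<open>q\<close> the parity of \<open>m\<close>, the symmetries of \<open>V\<close> continue the chain past its end by
  \<open>V (n + 1) = \<epsilon> * V n\<close> if \<open>q = 1\<close>, and by \<open>V (n + 1) = V (n - 1)\<close> if \<open>q = 0\<close>; the boundary
  term \<open>e\<close> is chosen to make the stationarity condition at \<open>n\<close> come out accordingly.\<close>

lemma symmetric_solutions:
  fixes e e' :: "real \<Rightarrow> real" and q :: int and \<epsilon> :: real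
  assumes ell: "curvature g c * (2 * cmod (g c)) < 2"
    and conte: "continuous_on UNIV e"
    and de: "\<And>a. a \<in> {0..1/4} \<Longrightarrow> (e has_real_derivative e' a) (at a)"
    and e': "0 \<le> e' 0" "e' (1/4) \<le> 0"
    and q: "q = 1 \<or> q = 0 \<and> \<epsilon> = 1" and \<epsilon>: "\<epsilon> = 1 \<or> \<epsilon> = -1"
    and ends: "\<And>a b. 0 < a \<Longrightarrow> a < 1/4 \<Longrightarrow> dchord a b + e' a = 0 \<Longrightarrow>
      dchord a b + dchord a (if q = 1 then \<epsilon> * a else b) = 0"
  obtains V m where "N \<le> m" "m mod 2 = q" "stationary V" "\<And>i. V (i + m) = - \<epsilon> * V i"
    "\<And>i. V (- i) = - V i" "\<And>i. V i = 0 \<longleftrightarrow> m dvd i" "\<And>i. \<bar>V i\<bar> < 1/4"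
proof -
  obtain n0 where n0: "\<And>n. n \<ge> n0 \<Longrightarrow> \<exists>v :: nat \<Rightarrow> real. v 0 = 0 \<and>
    (\<forall>i\<in>{1..n}. 0 < v i \<and> v i < 1/4) \<and>
    (\<forall>i\<in>{1..n}. dchord (v i) (v (i - 1))
       + (if i < n then dchord (v i) (v (Suc i)) else e' (v i)) = 0)"
    using critical_chains[OF ell conte de e'] by blast
  \<comment> \<open>\<open>Suc n0\<close> keeps the chain nonempty, and \<open>nat N\<close> makes
    \<open>m\<close> at least \<open>N\<close>.\<close>
  define n where "n = max (Suc n0) (nat N)"
  have n: "0 < n" "n0 \<le> n" "N \<le> int n" by (auto simp: n_def)
  obtain v :: "nat \<Rightarrow> real" where v0: "v 0 = 0"
    and v: "\<And>i. i \<in> {1..n} \<Longrightarrow> 0 < v i \<and> v i < 1/4"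
    and crit: "\<And>i. i \<in> {1..n} \<Longrightarrow> dchord (v i) (v (i - 1))
       + (if i < n then dchord (v i) (v (Suc i)) else e' (v i)) = 0"
    using n0[OF n(2)] by blast
  define m where "m = 2 * int n + q"
  have m: "m = 2 * int n + 1 \<or> m = 2 * int n \<and> \<epsilon> = 1" using q by (auto simp: m_def)
  obtain V where V: "\<And>i. V (i + m) = - \<epsilon> * V i" "\<And>i. V (- i) = - V i"
      "\<And>i. V i = 0 \<longleftrightarrow> m dvd i"
    and Vv: "\<And>i. i \<le> n \<Longrightarrow> V (int i) = v i" and bound: "\<And>i. \<bar>V i\<bar> < 1/4"
    using symmetric_extension[where n = n and v = v and r = "1/4" and m = m and \<epsilon> = \<epsilon>,
        OF v0 v \<epsilon> n(1) m] by blast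
  have stat: "stationary V"
  proof (rule stationary_extension[OF V(1,2) \<epsilon>])
    show "0 < m" "m \<le> 2 * int n + 1" using m n by auto
    fix i assume i: "1 \<le> i" "i \<le> int n"
    define j where "j = nat i"
    have j: "i = int j" "j \<in> {1..n}" using i by (auto simp: j_def)
    have "V i = v j" using Vv[of j] j by simp
    moreover have "V (i - 1) = v (j - 1)"
    proof -
      have "j - 1 \<le> n" "int (j - 1) = i - 1" using j by auto
      then show ?thesis using Vv[of "j - 1"] by simp
    qed
    ultimately show "dchord (V i) (V (i - 1)) + dchord (V i) (V (i + 1)) = 0"
    proof (cases "j < n")
      case True
      moreover have "V (i + 1) = v (Suc j)" using Vv[of "Suc j"] True j by (simp add: add.commute)
      ultimately show ?thesis
        using crit[OF j(2)] \<open>V i = v j\<close> \<open>V (i - 1) = v (j - 1)\<close> by simp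
    next
      case False
      then have "j = n" using j by simp
      have refl: "V (m - k) = \<epsilon> * V k" for k
        using V(1)[of "- k"] V(2)[of k] by (simp add: algebra_simps)
      \<comment> \<open>Here \<open>i = n\<close>: for \<open>m = 2 * n + 1\<close> one has
        \<open>m - n = n + 1\<close>, and for \<open>m = 2 * n\<close> one has
        \<open>m - (n - 1) = n + 1\<close>.\<close>
      have "V (i + 1) = (if q = 1 then \<epsilon> * V i else V (i - 1))"
        using q refl[of i] refl[of "i - 1"] \<open>j = n\<close> j(1) by (auto simp: m_def algebra_simps)
      moreover have "dchord (V i) (V (i - 1)) + e' (V i) = 0"
        using crit[OF j(2)] False \<open>V i = v j\<close> \<open>V (i - 1) = v (j - 1)\<close> by simp
      ultimately show ?thesis
        using ends[of "V i" "V (i - 1)"] v[OF j(2)] \<open>V i = v j\<close> by simp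
    qed
  qed
  have "N \<le> m" "m mod 2 = q" using n q by (auto simp: m_def)
  from this stat V bound show thesis by (rule that)
qed

section \<open>From stationary sequences to billiard orbits\<close>

text \<open>The summand \<open>i / 2\<close> produces the alternating sign and the rotation number
  1/2; \<open>V\<close> is the deviation from the two-periodic orbit.\<close>

definition orbit :: "(int \<Rightarrow> real) \<Rightarrow> int \<Rightarrow> complex" where
  "orbit V i = g (c + V i + of_int i / 2)"

text \<open>An integer parameter difference makes \<open>2 * (a - b)\<close> an integer, and the
  bounds force it to be 0. Thus symmetries of an orbit become conditions on \<open>V\<close> and on
  parities of indices.\<close>

lemma g_shifted_eq_iff:
  assumes "\<bar>a\<bar> < 1/4" "\<bar>b\<bar> < 1/4"
  shows "g (c + a + of_int i / 2) = g (c + b + of_int j / 2) \<longleftrightarrow> even (i - j) \<and> a = b"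
proof
  assume "g (c + a + of_int i / 2) = g (c + b + of_int j / 2)"
  then have "c + a + of_int i / 2 - (c + b + of_int j / 2) \<in> \<int>" by (simp only: g_eq_iff)
  then obtain k :: int where "c + a + of_int i / 2 - (c + b + of_int j / 2) = of_int k"
    by (auto elim: Ints_cases)
  then have k: "2 * (a - b) = of_int (2 * k - (i - j))" by simp
  moreover have "\<bar>2 * (a - b)\<bar> < 1" using assms by (auto simp: abs_less_iff)
  ultimately have "2 * k - (i - j) = 0" by linarith
  then show "even (i - j) \<and> a = b" using k by (metis dvd_triv_left eq_iff_diff_eq_0
        mult_eq_0_iff of_int_0 zero_neq_numeral)
next
  assume *: "even (i - j) \<and> a = b"
  then obtain k where "i = j + 2 * k" by (metis add.commute diff_add_cancel evenE)
  then show "g (c + a + of_int i / 2) = g (c + b + of_int j / 2)"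
    using * g_int[of "c + b + of_int j / 2" k] by (simp add: add_divide_distrib algebra_simps)
qed

context
  fixes V :: "int \<Rightarrow> real"
  assumes bound: "\<And>i. \<bar>V i\<bar> < 1/4"
begin

lemma orbit_id_iff: "orbit V i = orbit V j \<longleftrightarrow> even (i - j) \<and> V i = V j"
  unfolding orbit_def by (rule g_shifted_eq_iff[OF bound bound])

lemma orbit_rotR_iff: "rotR (orbit V i) = orbit V j \<longleftrightarrow> odd (i - j) \<and> V i = V j"
proof -
  have "rotR (orbit V i) = g (c + V i + of_int (i + 1) / 2)"
    using g_half[of "c + V i + of_int i / 2"] by (simp add: orbit_def rotR_def add_divide_distrib add.assoc)
  then show ?thesis
    unfolding orbit_def[of V j] using g_shifted_eq_iff[OF bound bound, of i "i + 1" j j] by auto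
qed

lemma orbit_\<sigma>_iff: "\<sigma> (orbit V i) = orbit V j \<longleftrightarrow> even (i - j) \<and> V j = - V i"
proof -
  have "\<sigma> (orbit V i) = g (c + - V i + of_int (- i) / 2)"
    using refl[of "V i + of_int i / 2"] by (simp add: orbit_def algebra_simps)
  then show ?thesis
    unfolding orbit_def[of V j] using g_shifted_eq_iff[of "- V i" "V j" "- i" j] bound by auto
qed

lemma orbit_rotR_\<sigma>_iff: "rotR (\<sigma> (orbit V i)) = orbit V j \<longleftrightarrow> odd (i - j) \<and> V j = - V i"
proof -
  have "rotR (\<sigma> (orbit V i)) = \<sigma> (rotR (orbit V i))" by (simp add: rotR_def \<sigma>_minus)
  moreover have "rotR (orbit V i) = g (c + V i + of_int (i + 1) / 2)"
    using g_half[of "c + V i + of_int i / 2"] by (simp add: orbit_def rotR_def add_divide_distrib add.assoc)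
  moreover have "\<sigma> (g (c + V i + of_int (i + 1) / 2)) = g (c + - V i + of_int (- i - 1) / 2)"
    using refl[of "V i + of_int (i + 1) / 2"] by (simp add: algebra_simps add_divide_distrib diff_divide_distrib)
  ultimately show ?thesis
    unfolding orbit_def[of V j] using g_shifted_eq_iff[of "- V i" "V j" "- i - 1" j] bound by auto
qed

lemmas orbit_iffs = orbit_id_iff orbit_rotR_iff orbit_\<sigma>_iff orbit_rotR_\<sigma>_iff

text \<open>Passing from even to odd \<open>i\<close> flips the sign of both the chords and the
  velocity, so the reflection law is always the negative of the stationarity equation.\<close>

lemma orbit_is_lift:
  assumes "stationary V"
  shows "is_lift_of g (\<lambda>i. c + V i + of_int i / 2) (orbit V)"
  unfolding is_lift_of_def billiard_lift_def
proof (intro conjI allI)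
  fix i
  define x where "x i = c + V i + of_int i / 2" for i
  define y where "y i = g (c + V i)" for i
  define w where "w = vel g (c + V i)"
  have "\<bar>V (i + 1)\<bar> < 1/4" "\<bar>V i\<bar> < 1/4" by (rule bound)+
  then show "0 < c + V (i + 1) + of_int (i + 1) / 2 - (c + V i + of_int i / 2)"
    "c + V (i + 1) + of_int (i + 1) / 2 - (c + V i + of_int i / 2) < 1"
    by (simp_all add: add_divide_distrib abs_less_iff)
  have g: "g (x j) = (if even j then y j else - y j)" for j
    unfolding x_def y_def by (rule g_half_int)
  have vel: "vel g (x i) = (if even i then w else - w)"
    unfolding x_def w_def by (rule vel_half_int)
  have "sgn (y i + y (i - 1)) \<bullet> w + sgn (y i + y (i + 1)) \<bullet> w = 0"
    using assms unfolding stationary_def dchord_def y_def w_def by blast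
  moreover have "(sgn (g (x (i - 1)) - g (x i)) + sgn (g (x (i + 1)) - g (x i))) \<bullet> vel g (x i)
      = - (sgn (y i + y (i - 1)) \<bullet> w + sgn (y i + y (i + 1)) \<bullet> w)"
  proof (cases "even i")
    case True
    then have "g (x (i - 1)) - g (x i) = - (y i + y (i - 1))"
      "g (x (i + 1)) - g (x i) = - (y i + y (i + 1))" by (simp_all add: g)
    then show ?thesis using True by (simp only: vel sgn_minus) (simp add: inner_simps)
  next
    case False
    then have "g (x (i - 1)) - g (x i) = y i + y (i - 1)"
      "g (x (i + 1)) - g (x i) = y i + y (i + 1)" by (simp_all add: g)
    then show ?thesis using False by (simp only: vel) (simp add: inner_simps)
  qed
  ultimately show "(sgn (g (c + V (i - 1) + of_int (i - 1) / 2) - g (c + V i + of_int i / 2))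
      + sgn (g (c + V (i + 1) + of_int (i + 1) / 2) - g (c + V i + of_int i / 2)))
      \<bullet> vel g (c + V i + of_int i / 2) = 0"
    unfolding x_def by simp
qed (simp add: orbit_def)

lemma orbit_rotation_number: "rotation_number (\<lambda>i. c + V i + of_int i / 2) (1/2)"
proof -
  have "(\<lambda>n. (V (int n) - V 0) / real n) \<longlonglongrightarrow> 0"
  proof (rule Lim_null_comparison)
    show "\<forall>\<^sub>F n in sequentially. norm ((V (int n) - V 0) / real n) \<le> inverse (real n)"
    proof (intro always_eventually allI)
      fix n
      have "\<bar>V (int n) - V 0\<bar> \<le> 1" using bound[of "int n"] bound[of 0] by linarith
      then show "norm ((V (int n) - V 0) / real n) \<le> inverse (real n)"
        by (simp add: divide_inverse mult_left_le_one_le abs_mult)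
    qed
  qed (rule lim_inverse_n)
  then have "(\<lambda>n. 1/2 + (V (int n) - V 0) / real n) \<longlonglongrightarrow> 1/2 + 0"
    by (intro tendsto_add tendsto_const)
  moreover have "\<forall>\<^sub>F n in sequentially. 1/2 + (V (int n) - V 0) / real n
      = (c + V (int n) + of_int (int n) / 2 - (c + V 0 + of_int 0 / 2)) / real n"
    using eventually_gt_at_top[of 0] by eventually_elim (simp add: field_simps)
  ultimately show ?thesis
    unfolding rotation_number_def by (simp add: tendsto_cong)
qed

text \<open>The Birkhoff order would carry a comparison of \<open>V 0\<close> with
  \<open>V 2\<close> along all later even indices; monotonicity and the period \<open>2 * m\<close>
  then force \<open>V 2 = V 0\<close>.\<close>

lemma orbit_not_birkhoff:
  assumes per: "\<And>i. V (i + 2 * m) = V i" and m: "0 < m" and ne: "V 2 \<noteq> V 0"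
  shows "\<not> birkhoff (\<lambda>i. c + V i + of_int i / 2)"
proof
  assume B: "birkhoff (\<lambda>i. c + V i + of_int i / 2)"
  \<comment> \<open>An index gap of \<open>2 * l\<close> adds \<open>l\<close> to the term
    \<open>i / 2\<close> of the lift, which the integer shift in \<open>birkhoff\<close>
    undoes.\<close>
  have mono: "V (i + k) \<le> V (j + k)" if le: "V i \<le> V j" and ev: "even (j - i)" for i j k
  proof -
    obtain l where l: "j = i + 2 * l" using ev by (metis add.commute diff_add_cancel evenE)
    have "c + V i + of_int i / 2 \<le> c + V j + of_int j / 2 + of_int (- l)"
      using le l by (simp add: add_divide_distrib)
    then have "c + V (i + k) + of_int (i + k) / 2 \<le> c + V (j + k) + of_int (j + k) / 2 + of_int (- l)"
      using B unfolding birkhoff_def by blast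
    then show ?thesis using l by (simp add: add_divide_distrib)
  qed
  have wrap: "V (2 + 2 * int (nat (m - 1))) = V 0" using per[of 0] m by simp
  consider "V 0 \<le> V 2" | "V 2 \<le> V 0" by linarith
  then show False
  proof cases
    case 1
    have "V 2 \<le> V (2 + 2 * int k)" for k
    proof (induction k)
      case (Suc k)
      then show ?case using mono[OF 1, of "2 + 2 * int k"] by (simp add: algebra_simps)
    qed simp
    then show False using 1 ne wrap by (metis order_antisym)
  next
    case 2
    have "V (2 + 2 * int k) \<le> V 2" for k
    proof (induction k)
      case (Suc k)
      then show ?case using mono[OF 2, of "2 + 2 * int k"] by (simp add: algebra_simps)
    qed simp
    then show False using 2 ne wrap by (metis order_antisym)
  qed
qed

end

text \<open>The zeros of \<open>V\<close> are the multiples of \<open>m\<close>, so every period is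
  one of them, and below \<open>2 * m\<close> only \<open>m\<close> is left. If \<open>m\<close> is
  odd this fails since periods are even; if \<open>\<epsilon> = 1\<close> it would give
  \<open>V 1 = - V 1\<close>.\<close>

lemma symmetric_orbit_properties:
  assumes stat: "stationary V" and per: "\<And>i. V (i + m) = - \<epsilon> * V i"
    and zero: "\<And>i. V i = 0 \<longleftrightarrow> m dvd i" and bound: "\<And>i. \<bar>V i\<bar> < 1/4"
    and \<epsilon>: "\<epsilon> = 1 \<or> \<epsilon> = -1" and m: "3 \<le> m" "odd m \<or> \<epsilon> = 1"
  shows "min_period (orbit V) (2 * m)"
    and "\<exists>x. is_lift_of g x (orbit V) \<and> rotation_number x (1/2) \<and> \<not> birkhoff x"
proof -
  have per2: "V (i + 2 * m) = V i" for i
    using per[of i] per[of "i + m"] \<epsilon> by (auto simp: algebra_simps)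
  have V0: "V 0 = 0" using zero[of 0] by simp
  have "\<not> (\<forall>i. orbit V (i + q) = orbit V i)" if q: "0 < q" "q < 2 * m" for q
  proof
    assume "\<forall>i. orbit V (i + q) = orbit V i"
    then have eq: "even q" "\<And>i. V (i + q) = V i" by (auto simp: orbit_iffs[OF bound])
    then have "m dvd q" using zero[of q] eq(2)[of 0] V0 by simp
    then obtain k where "q = m * k" ..
    then have "0 < k" "k < 2" using q m by (auto simp: zero_less_mult_iff)
    then have "q = m" using \<open>q = m * k\<close> by simp
    then have "V 1 = 0" using eq per[of 1] m(2) by auto
    then show False using zero[of 1] m by simp
  qed
  then show "min_period (orbit V) (2 * m)"
    using m per2 by (auto simp: min_period_def orbit_iffs[OF bound])
  have "\<not> m dvd 2" using m zdvd_imp_le[of m 2] by auto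
  then have "V 2 \<noteq> V 0" unfolding V0 zero .
  then show "\<exists>x. is_lift_of g x (orbit V) \<and> rotation_number x (1/2) \<and> \<not> birkhoff x"
    using orbit_is_lift[OF bound stat] orbit_rotation_number[OF bound]
      orbit_not_birkhoff[where V = V, OF bound per2] m by (intro exI conjI) auto
qed

section \<open>The three symmetry types\<close>

text \<open>With \<open>m\<close> odd and \<open>\<epsilon> = -1\<close>, \<open>V\<close> has
  period \<open>m\<close>, so \<open>rotR\<close> shifts by \<open>m\<close> and both reflections
  reverse time. The chain continues by \<open>V (n + 1) = - V n\<close>, and the boundary term is
  half of \<open>chord a (- a)\<close>: the component of \<open>g (c + a)\<close> along the axis of
  \<open>\<sigma>\<close>.\<close>

lemma typeI_orbits:
  assumes ell: "curvature g c * (2 * cmod (g c)) < 2"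
  shows "\<exists>z p. N \<le> p \<and> min_period z p \<and> typeI z p \<and>
    (\<exists>x. is_lift_of g x z \<and> rotation_number x (1/2) \<and> \<not> birkhoff x)"
proof -
  interpret q: axis_curve g "c - 1/4" "rotR \<circ> \<sigma>" by (rule axis_quarter)
  \<comment> \<open>At \<open>c - 1/4\<close> the velocity points along the fixed line of
    \<open>\<sigma>\<close>; orienting \<open>u\<close> by it makes
    \<open>g (c + a) \<bullet> u\<close> positive for \<open>0 < a < 1/4\<close>.\<close>
  define w where "w = vel g (c - 1/4)"
  define u where "u = sgn w"
  have w: "w \<noteq> 0" unfolding w_def by (rule vel_nonzero)
  have "\<sigma> w = w" using q.\<sigma>_vel by (simp add: w_def rotR_def)
  then have u: "\<sigma> u = u" "cmod u = 1" using w by (simp_all add: u_def \<sigma>_sgn norm_sgn)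
  have proj: "y + \<sigma> y = (2 * (y \<bullet> u)) *\<^sub>R u" for y
  proof -
    have "(Re u)\<^sup>2 + (Im u)\<^sup>2 = 1" using u(2) by (simp add: cmod_def)
    then show ?thesis
      using \<sigma>_cases u(1)
      by (auto simp: complex_eq_iff inner_complex_def power2_eq_square algebra_simps)
  qed
  have dchord_sym: "dchord a (- a) = vel g (c + a) \<bullet> u" if "0 < a" "a < 1/4" for a
  proof -
    have "0 < g (c + a) \<bullet> u"
      using q.g_inner_vel_pos[of "a + 1/4"] that w
      unfolding inner_commute[of "g (c + a)"] u_def sgn_inner w_def
      by (simp add: inner_commute[of "vel g (c - 1/4)"])
    moreover have "g (c + a) + g (c + - a) = (2 * (g (c + a) \<bullet> u)) *\<^sub>R u"
      using refl[of a] proj[of "g (c + a)"] by simp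
    ultimately have "sgn (g (c + a) + g (c + - a)) = u"
      using u(2) by (simp add: sgn_scaleR sgn_div_norm[of u])
    then show ?thesis by (simp add: dchord_def inner_commute)
  qed
  have e'0: "vel g c \<bullet> u = 0"
    using \<sigma>_inner[of "vel g c" u] u(1) \<sigma>_vel by simp
  have e'r: "vel g (c + 1/4) \<bullet> u \<le> 0"
  proof -
    have "vel g (c + 1/4) = - w" using vel_half[of "c - 1/4"] by (simp add: w_def add.commute)
    moreover have "0 \<le> u \<bullet> w" unfolding u_def sgn_inner by simp
    ultimately show ?thesis using inner_commute[of w u] by simp
  qed
  obtain V m where m: "max 3 N \<le> m" "m mod 2 = 1" and stat: "stationary V"
    and per: "\<And>i. V (i + m) = - (-1) * V i" and odd: "\<And>i. V (- i) = - V i"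
    and zero: "\<And>i. V i = 0 \<longleftrightarrow> m dvd i" and bound: "\<And>i. \<bar>V i\<bar> < 1/4"
  proof (rule symmetric_solutions[where e = "\<lambda>a. g (c + a) \<bullet> u" and N = "max 3 N"
        and e' = "\<lambda>a. vel g (c + a) \<bullet> u" and q = 1 and \<epsilon> = "-1", OF ell])
    show "continuous_on UNIV (\<lambda>a. g (c + a) \<bullet> u)"
      by (intro continuous_intros continuous_on_compose2[OF continuous_g[of UNIV]]) auto
    show "((\<lambda>a. g (c + a) \<bullet> u) has_real_derivative vel g (c + a) \<bullet> u) (at a)" for a
      by (rule has_real_derivative_inner_const[OF g_shift_deriv])
  qed (use e'0 e'r dchord_sym in auto)
  have m': "odd m" using m(2) by presburger
  note props = symmetric_orbit_properties[where V = V and m = m and \<epsilon> = "-1", OF stat per zero bound]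
  note iffs = orbit_iffs[OF bound]
  have R: "rotR (orbit V i) = orbit V (m + i)" for i
    using m' per[of i] by (simp add: iffs add.commute)
  have S: "\<sigma> (orbit V i) = orbit V (0 - i)" for i
    using odd by (simp add: iffs)
  have RS: "rotR (\<sigma> (orbit V i)) = orbit V (m - i)" for i
    using m' per[of "- i"] odd by (simp add: iffs)
  have "symH (orbit V) = D2"
  proof (rule antisym[OF symH_subset_D2])
    have "rotR \<in> symH (orbit V)" by (rule symH_shiftI[where k = m]) (simp_all add: D2_eq R)
    moreover have "\<sigma> \<in> symH (orbit V)" by (rule symH_reflectionI[where k = 0]) (simp_all add: D2_eq S)
    moreover have "rotR \<circ> \<sigma> \<in> symH (orbit V)"
      by (rule symH_reflectionI[where k = m]) (simp_all add: D2_eq RS)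
    ultimately show "D2 \<subseteq> symH (orbit V)" using id_in_symH by (simp add: D2_eq)
  qed
  moreover have "\<exists>k. \<forall>i. reflS (orbit V i) = orbit V (k - i)"
  proof -
    have "reflS = \<sigma> \<or> reflS = rotR \<circ> \<sigma>" using \<sigma> by (auto simp: rotR_def fun_eq_iff)
    then show ?thesis
    proof
      assume "reflS = \<sigma>"
      then show ?thesis using S by (intro exI[of _ 0]) simp
    next
      assume eq: "reflS = rotR \<circ> \<sigma>"
      show ?thesis unfolding eq comp_apply using RS by blast
    qed
  qed
  ultimately have "typeI (orbit V) (2 * m)" using R by (simp add: typeI_def)
  moreover have "N \<le> 2 * m" "3 \<le> m" using m by auto
  ultimately show ?thesis using props m' by blast
qed

text \<open>With \<open>m\<close> odd and \<open>\<epsilon> = 1\<close>, translation by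
  \<open>m\<close> negates \<open>V\<close>, so \<open>rotR \<circ> \<sigma>\<close> shifts by
  \<open>m\<close> and \<open>rotR\<close> reverses time with the odd \<open>k = m\<close>. Here
  \<open>V (n + 1) = V n\<close>, and the boundary term is half of \<open>chord a a\<close>, with
  zero derivative at both axes.\<close>

lemma typeII_orbits:
  assumes ell: "curvature g c * (2 * cmod (g c)) < 2"
  shows "\<exists>z p. N \<le> p \<and> min_period z p \<and> typeII z p \<and>
    (\<exists>x. is_lift_of g x z \<and> rotation_number x (1/2) \<and> \<not> birkhoff x)"
proof -
  interpret q: axis_curve g "c + 1/4" "rotR \<circ> \<sigma>" by (rule axis_quarter)
  have dchord_diag: "dchord a a = sgn (g (c + a)) \<bullet> vel g (c + a)" for a
    unfolding dchord_def scaleR_2[symmetric] sgn_scaleR by simp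
  obtain V m where m: "max 3 N \<le> m" "m mod 2 = 1" and stat: "stationary V"
    and per: "\<And>i. V (i + m) = - 1 * V i" and odd: "\<And>i. V (- i) = - V i"
    and zero: "\<And>i. V i = 0 \<longleftrightarrow> m dvd i" and bound: "\<And>i. \<bar>V i\<bar> < 1/4"
  proof (rule symmetric_solutions[where e = "\<lambda>a. norm (g (c + a))" and N = "max 3 N"
        and e' = "\<lambda>a. sgn (g (c + a)) \<bullet> vel g (c + a)" and q = 1 and \<epsilon> = 1, OF ell])
    show "continuous_on UNIV (\<lambda>a. norm (g (c + a)))"
      by (intro continuous_intros continuous_on_compose2[OF continuous_g[of UNIV]]) auto
    show "((\<lambda>a. norm (g (c + a))) has_real_derivative sgn (g (c + a)) \<bullet> vel g (c + a)) (at a)" for a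
      by (rule has_real_derivative_norm[OF g_shift_deriv g_nonzero])
    show "0 \<le> sgn (g (c + 0)) \<bullet> vel g (c + 0)" "sgn (g (c + 1/4)) \<bullet> vel g (c + 1/4) \<le> 0"
      using g_inner_vel q.g_inner_vel by (simp_all add: sgn_inner)
  qed (auto simp: dchord_diag)
  have m': "odd m" using m(2) by presburger
  note props = symmetric_orbit_properties[where V = V and m = m and \<epsilon> = 1, OF stat per zero bound]
  note iffs = orbit_iffs[OF bound]
  have R: "rotR (orbit V i) = orbit V (m - i)" for i
    using m' per[of "- i"] odd by (simp add: iffs)
  have S: "\<sigma> (orbit V i) = orbit V (0 - i)" for i
    using odd by (simp add: iffs)
  have RS: "rotR (\<sigma> (orbit V i)) = orbit V (m + i)" for i
    using m' per[of i] by (simp add: iffs add.commute)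
  have "symH (orbit V) = D2"
  proof (rule antisym[OF symH_subset_D2])
    have "rotR \<in> symH (orbit V)" by (rule symH_reflectionI[where k = m]) (simp_all add: D2_eq R)
    moreover have "\<sigma> \<in> symH (orbit V)" by (rule symH_reflectionI[where k = 0]) (simp_all add: D2_eq S)
    moreover have "rotR \<circ> \<sigma> \<in> symH (orbit V)"
      by (rule symH_shiftI[where k = m]) (simp_all add: D2_eq RS)
    ultimately show "D2 \<subseteq> symH (orbit V)" using id_in_symH by (simp add: D2_eq)
  qed
  moreover have "(\<forall>i. reflS (orbit V i) = orbit V (m + i)) \<or>
      (\<forall>i. (rotR \<circ> reflS) (orbit V i) = orbit V (m + i))"
    using \<sigma> RS by (auto simp: rotR_def)
  ultimately have "typeII (orbit V) (2 * m)" using R m' by (auto simp: typeII_def)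
  moreover have "N \<le> 2 * m" "3 \<le> m" using m by auto
  ultimately show ?thesis using props m' by blast
qed

text \<open>With \<open>m\<close> even, translation by \<open>m\<close> negates \<open>V\<close> and
  keeps parity, so \<open>\<sigma>\<close> is both a shift and a time reversal. The free end
  \<open>e = 0\<close> matches \<open>V (n + 1) = V (n - 1)\<close>.\<close>

lemma typeV_orbits:
  assumes ell: "curvature g c * (2 * cmod (g c)) < 2"
  shows "\<exists>z p. N \<le> p \<and> min_period z p \<and> typeV z p \<and>
    (\<exists>x. is_lift_of g x z \<and> rotation_number x (1/2) \<and> \<not> birkhoff x)"
proof -
  obtain V m where m: "max 3 N \<le> m" "m mod 2 = 0" and stat: "stationary V"
    and per: "\<And>i. V (i + m) = - 1 * V i" and odd: "\<And>i. V (- i) = - V i"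
    and zero: "\<And>i. V i = 0 \<longleftrightarrow> m dvd i" and bound: "\<And>i. \<bar>V i\<bar> < 1/4"
    by (rule symmetric_solutions[where e = "\<lambda>a. 0" and N = "max 3 N"
        and e' = "\<lambda>a. 0" and q = 0 and \<epsilon> = 1, OF ell]) auto
  have m': "even m" using m(2) by presburger
  note props = symmetric_orbit_properties[where V = V and m = m and \<epsilon> = 1, OF stat per zero bound]
  note iffs = orbit_iffs[OF bound]
  have V0: "V 0 = 0" using zero[of 0] by simp
  have S: "\<sigma> (orbit V i) = orbit V (m + i)" "\<sigma> (orbit V i) = orbit V (0 - i)" for i
    using m' per[of i] odd by (simp_all add: iffs add.commute)
  \<comment> \<open>\<open>rotR\<close> and \<open>rotR \<circ> \<sigma>\<close> change parity, so
    either would move the zero at index 0 to an odd index, but zeros are multiples of the even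
    \<open>m\<close>.\<close>
  have no: "\<not> (odd k \<and> V k = 0)" for k
    using zero[of k] m' by (meson dvd_trans)
  have R: "rotR (orbit V 0) \<noteq> orbit V k" "rotR (\<sigma> (orbit V 0)) \<noteq> orbit V k" for k
    using no[of k] V0 by (auto simp: iffs)
  have sym: "symH (orbit V) = {id, \<sigma>}"
  proof -
    have "rotR \<notin> symH (orbit V)" using symH_imp_ex[of rotR "orbit V"] R(1) by blast
    moreover have "rotR \<circ> \<sigma> \<notin> symH (orbit V)"
      using symH_imp_ex[of "rotR \<circ> \<sigma>" "orbit V"] R(2) unfolding comp_apply by blast
    moreover have "\<sigma> \<in> symH (orbit V)" by (rule symH_reflectionI[where k = 0]) (simp_all add: D2_eq S(2))
    ultimately show ?thesis
      using id_in_symH[of "orbit V"] symH_subset_D2[of "orbit V"] unfolding D2_eq by blast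
  qed
  have "typeV (orbit V) (2 * m)"
  proof -
    have "\<exists>k. \<forall>i. \<sigma> (orbit V i) = orbit V (k - i)" using S(2) by blast
    then show ?thesis
      unfolding typeV_def using \<sigma> sym S(1) by (intro conjI bexI[of _ \<sigma>]) simp_all
  qed
  moreover have "N \<le> 2 * m" "3 \<le> m" using m by auto
  ultimately show ?thesis using props by blast
qed

end

section \<open>From the two-periodic orbit to an axis\<close>

theorem mainTheorem4:
  fixes g :: "real \<Rightarrow> complex" and xZ :: "int \<Rightarrow> real" and Z :: "int \<Rightarrow> complex"
  assumes "D2_billiard_curve g"
    and "is_lift_of g xZ Z"
    and "min_period Z 2"
    and "symH Z = D2"
    and "birkhoff xZ"
    and "curvature g (xZ 0) * cmod (Z 1 - Z 0) < 2"
  shows "\<forall>T \<in> {typeI, typeII, typeV}. \<forall>N::int. \<exists>z p. N \<le> p \<and> min_period z p \<and> T z p \<and>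
           (\<exists>x. is_lift_of g x z \<and> rotation_number x (1/2) \<and> \<not> birkhoff x)"
proof -
  interpret billiard_curve g by unfold_locales (rule assms(1))
  define c where "c = xZ 0"
  have Z0: "Z 0 = g c" using assms(2) by (simp add: is_lift_of_def c_def)
  have per: "Z (i + 2) = Z i" for i using assms(3) by (simp add: min_period_def)
  have per_mult: "Z (i + 2 * k) = Z i" for i k
  proof (induction k rule: int_induct[where k = 0])
    case (step1 k)
    then show ?case using per[of "i + 2 * k"] by (simp add: algebra_simps)
  next
    case (step2 k)
    then show ?case using per[of "i + 2 * (k - 1)"] by (simp add: algebra_simps)
  qed simp
  have Z_cases: "Z k = Z 0 \<or> Z k = Z 1" for k
    using per_mult[of 0 "k div 2"] per_mult[of 1 "k div 2"]
    by (cases "even k") (simp_all add: add.commute[of 1])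
  have H: "h (Z 0) = Z 0 \<or> h (Z 0) = Z 1" if "h \<in> D2" for h
  proof -
    have "h \<in> symH Z" using that assms(4) by simp
    then obtain k where "h (Z 0) = Z k" using symH_imp_ex by blast
    then show ?thesis using Z_cases[of k] by simp
  qed
  \<comment> \<open>\<open>rotR\<close> cannot fix \<open>Z 0\<close>, which is not the origin, so
    it swaps the two points of the orbit.\<close>
  have Z1: "Z 1 = - g c"
    using H[of rotR] g_nonzero[of c] by (auto simp: D2_def rotR_def Z0)
  \<comment> \<open>The reflection fixes \<open>Z 0\<close> or maps it to \<open>- Z 0\<close>;
    accordingly \<open>Z 0\<close> lies on the axis of \<open>reflS\<close> or of
    \<open>rotR \<circ> reflS\<close>.\<close>
  have "g (- c) = g c \<or> g (- c) = g (c + 1/2)"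
    using H[of reflS] by (simp add: D2_def reflS_def Z0 Z1 g_cnj g_half)
  then have "\<exists>\<sigma>. axis_curve g c \<sigma>"
  proof
    assume "g (- c) = g c"
    then have "- c - c \<in> \<int>" by (simp only: g_eq_iff)
    \<comment> \<open>The integer \<open>- c - c\<close> is also the difference of
      \<open>- (c + t)\<close> and \<open>c - t\<close>, which spreads the symmetry to every
      \<open>t\<close>.\<close>
    then have "g (- (c + t)) = g (c - t)" for t by (simp add: g_eq_iff)
    then have "g (c - t) = reflS (g (c + t))" for t by (simp add: reflS_def g_cnj[symmetric])
    then show ?thesis by (intro exI[of _ reflS]) (unfold_locales, simp_all)
  next
    assume "g (- c) = g (c + 1/2)"
    then have "- c - (c + 1/2) \<in> \<int>" by (simp only: g_eq_iff)
    then have "g (- (c + t)) = g (c - t + 1/2)" for t by (simp add: g_eq_iff algebra_simps)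
    then have "cnj (g (c + t)) = - g (c - t)" for t by (simp only: g_half g_cnj)
    then have "g (c - t) = (rotR \<circ> reflS) (g (c + t))" for t by (simp add: reflS_def rotR_def)
    then show ?thesis by (intro exI[of _ "rotR \<circ> reflS"]) (unfold_locales, simp_all)
  qed
  then obtain \<sigma> where "axis_curve g c \<sigma>" ..
  then interpret axis_curve g c \<sigma> .
  have "Z 1 - Z 0 = - (2 * g c)" by (simp add: Z0 Z1)
  then have "cmod (Z 1 - Z 0) = 2 * cmod (g c)" by (simp only: norm_minus_cancel norm_mult norm_numeral)
  then have "curvature g c * (2 * cmod (g c)) < 2" using assms(6) by (simp add: c_def)
  then show ?thesis using typeI_orbits typeII_orbits typeV_orbits by blast
qed

end
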